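(* Let $(\Omega,\mathcal F,\mu)$ be a probability space. For every bounded non-negative measurable function $f$ on $\Omega$, the map $p\mapsto M_p(f):=\sup_{c\ge 0}\Psi_p(f+c)$ is non-decreasing on $[1,2]$.
   Context: For a non-negative $f\in L^2(\mu)$ and $1\le p<2$, with $\mu(g):=\int g\,d\mu$, $$\Psi_p(f):=\frac{\mu(f^2)-\mu(f^p)^{2/p}}{2-p},$$ and at the endpoint $p=2$ the continuous extension is used: $$\Psi_2(f):=\tfrac12\mathrm{Ent}_\mu(f^2),\qquad \mathrm{Ent}_\mu(f^2)=\mu(f^2\log f^2)-\mu(f^2)\log\mu(f^2),$$ with the convention $0\log 0=0$. *)

theory Defs
  imports "HOL-Probability.Probability"
begin

text \<open>
  The library has \<^prop>\<open>ln (0::real) = 0\<close>, which realises the convention $0 \log 0 = 0$.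
\<close>

definition Ent :: "'a measure \<Rightarrow> ('a \<Rightarrow> real) \<Rightarrow> real" where
  "Ent \<mu> g = (\<integral>x. g x * ln (g x) \<partial>\<mu>) - (\<integral>x. g x \<partial>\<mu>) * ln (\<integral>x. g x \<partial>\<mu>)"

text \<open>
  Intended for \<^term>\<open>p \<in> {1..2::real}\<close> and non-negative square-integrable \<open>f\<close>. Since
  \<^prop>\<open>(0::real) powr p = 0\<close> for every \<open>p\<close>, the real powers below are the usual ones
  also where their base vanishes.
\<close>

definition Psi :: "'a measure \<Rightarrow> real \<Rightarrow> ('a \<Rightarrow> real) \<Rightarrow> real" where
  "Psi \<mu> p f =
    (if p = 2 then 1 / 2 * Ent \<mu> (\<lambda>x. (f x)\<^sup>2)
     else ((\<integral>x. (f x)\<^sup>2 \<partial>\<mu>) - (\<integral>x. f x powr p \<partial>\<mu>) powr (2 / p)) / (2 - p))"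

text \<open>
  The supremum is taken in the extended reals, so that it is meaningful without a
  prior proof that the set of values is bounded above.
\<close>

definition M_sup :: "'a measure \<Rightarrow> real \<Rightarrow> ('a \<Rightarrow> real) \<Rightarrow> ereal" where
  "M_sup \<mu> p f = (SUP c\<in>{0::real..}. ereal (Psi \<mu> p (\<lambda>x. f x + c)))"

end

theory Submission
  imports Defs
begin

text \<open>
  Write \<open>G(p, c) = \<Psi>\<^sub>p(f + c)\<close>, so that \<open>M\<^sub>p(f) = sup\<^sub>c G(p, c)\<close>. For a fixed function,
  \<open>p \<mapsto> \<Psi>\<^sub>p\<close> need not increase; the shift \<open>c\<close> has to move together with \<open>p\<close>. The right speed is
  \<open>v(p, c) = \<parallel>f + c\<parallel>\<^sub>p / (p - 1)\<close>, because for \<open>1 < p < 2\<close> and \<open>c > 0\<close>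
  \[ \partial_p G(p, c) + v(p, c)\, \partial_c G(p, c) \ge 0. \]
  Hence \<open>G\<close> does not decrease along solutions of \<open>c' = v(p, c)\<close>. As \<open>v \<ge> 0\<close>, such a solution stays
  among the admissible shifts, and \<open>G(a, c) \<le> M\<^sub>b(f)\<close> follows for \<open>a < b\<close>.

  The differential inequality (\<open>Psi_ascent_direction\<close>) is the integral of a pointwise one. After
  normalising \<open>g = f + c\<close> to \<open>\<parallel>g\<parallel>\<^sub>p = 1\<close> it says
  \[ \int g^2 - 1 - \frac{2(2-p)}{p} \int g^p \ln g
     + \frac{2(2-p)}{p-1} \Bigl(\int g - \int g^{p-1}\Bigr) \ge 0, \]
  and, with a Lagrange multiplier \<open>\<kappa>\<close> for the constraint \<open>\<integral> g\<^sup>p = 1\<close>, the integrand is non-negative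
  everywhere (\<open>pointwise_power_entropy_inequality\<close>). The coefficient of the last integral term and \<open>\<kappa>\<close> are
  forced: they are the only values for which the integrand vanishes to fourth order at \<open>g = 1\<close>.

  No solution of the differential equation is constructed. On the region
  \<open>c\<^sub>0 \<le> c \<le> c\<^sub>0 + R (p - a)\<close> the speed is at most \<open>R = (c\<^sub>0 + sup f) / (a - 1)\<close>, and a compactness
  argument (\<open>ascending_flow_reaches_end\<close>) shows that \<open>p\<close> can be pushed to \<open>b\<close> while losing an arbitrarily
  small amount of \<open>G\<close>. This settles \<open>1 < a\<close> and \<open>c > 0\<close>. The endpoint \<open>b = 2\<close> is covered because \<open>G\<close>
  is continuous there, half the entropy of \<open>g\<^sup>2\<close> being the derivative of \<open>p \<mapsto> \<parallel>g\<parallel>\<^sub>p\<^sup>2\<close> at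
  \<open>2\<close>; the boundary cases
  \<open>a = 1\<close> and \<open>c = 0\<close> follow by continuity of \<open>G\<close> from the right.
\<close>

section \<open>The pointwise inequality\<close>

lemma derivative_sign_change_imp_min_at_1:
  fixes F F' :: "real \<Rightarrow> real"
  assumes deriv: "\<And>x. 0 < x \<Longrightarrow> (F has_real_derivative F' x) (at x)"
    and below: "\<And>x. 0 < x \<Longrightarrow> x \<le> 1 \<Longrightarrow> F' x \<le> 0"
    and above: "\<And>x. 1 \<le> x \<Longrightarrow> 0 \<le> F' x"
    and "0 < x"
  shows "F 1 \<le> F x"
proof (cases "x \<le> 1")
  case True
  then show ?thesis
  proof (rule DERIV_nonpos_imp_nonincreasing)
    show "\<exists>y. (F has_real_derivative y) (at r) \<and> y \<le> 0" if "x \<le> r" "r \<le> 1" for r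
      using deriv[of r] below[of r] \<open>0 < x\<close> that by auto
  qed
next
  case False
  then have "1 \<le> x" by simp
  then show ?thesis
  proof (rule DERIV_nonneg_imp_nondecreasing)
    show "\<exists>y. (F has_real_derivative y) (at r) \<and> 0 \<le> y" if "1 \<le> r" for r
      using deriv[of r] above[of r] that by auto
  qed
qed

lemma derivative_nonneg_imp_sign_change_at_1:
  fixes F F' :: "real \<Rightarrow> real"
  assumes deriv: "\<And>x. 0 < x \<Longrightarrow> (F has_real_derivative F' x) (at x)"
    and nonneg: "\<And>x. 0 < x \<Longrightarrow> 0 \<le> F' x"
    and "F 1 = 0" and "0 < x"
  shows "x \<le> 1 \<Longrightarrow> F x \<le> 0" and "1 \<le> x \<Longrightarrow> 0 \<le> F x"
proof -
  have mono: "F s \<le> F t" if "0 < s" "s \<le> t" for s t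
  proof (rule DERIV_nonneg_imp_nondecreasing[OF \<open>s \<le> t\<close>])
    show "\<exists>y. (F has_real_derivative y) (at r) \<and> 0 \<le> y" if "s \<le> r" for r
      using deriv[of r] nonneg[of r] \<open>0 < s\<close> that by auto
  qed
  show "F x \<le> 0" if "x \<le> 1"
    using mono[of x 1] that \<open>0 < x\<close> \<open>F 1 = 0\<close> by simp
  show "0 \<le> F x" if "1 \<le> x"
    using mono[of 1 x] that \<open>F 1 = 0\<close> by simp
qed

text \<open>
  This bracket is, up to a positive factor, the highest derivative taken in the next proof.
  It is convex with a zero at \<open>1\<close> and negative at \<open>0\<close>, which determines its sign on both sides of \<open>1\<close>.
\<close>

lemma convex_bracket_sign:
  fixes p x :: real
  assumes p: "1 < p" "p < 2" and "0 < x"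
  defines "Q \<equiv> (\<lambda>x. (3 - p) * x - x powr (p - 1) - (2 - p))"
  shows "x \<le> 1 \<Longrightarrow> Q x \<le> 0" and "1 \<le> x \<Longrightarrow> 0 \<le> Q x"
proof -
  show "Q x \<le> 0" if "x \<le> 1"
  proof -
    have "x \<le> x powr (p - 1)"
      using powr_mono'[of "p - 1" 1 x] that p \<open>0 < x\<close> by simp
    then have "Q x \<le> (2 - p) * (x - 1)"
      unfolding Q_def by (simp add: algebra_simps)
    also have "\<dots> \<le> 0"
      using that p by (simp add: mult_nonneg_nonpos)
    finally show ?thesis .
  qed
  show "0 \<le> Q x" if "1 \<le> x"
  proof -
    have "\<exists>y. (Q has_real_derivative y) (at t) \<and> 0 \<le> y" if "1 \<le> t" for t
    proof (intro exI conjI)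
      show "(Q has_real_derivative (3 - p) - (p - 1) * t powr (p - 2)) (at t)"
        unfolding Q_def using that
        by (auto intro!: derivative_eq_intros has_real_derivative_powr)
      have "t powr (p - 2) \<le> 1"
        using powr_mono[of "p - 2" 0 t] that p by simp
      then have "(p - 1) * t powr (p - 2) \<le> p - 1"
        using p by (simp add: mult_left_le)
      then show "0 \<le> (3 - p) - (p - 1) * t powr (p - 2)"
        using p by linarith
    qed
    then have "Q 1 \<le> Q x"
      by (intro DERIV_nonneg_imp_nondecreasing[of 1 x Q]) (use that in auto)
    then show ?thesis by (simp add: Q_def)
  qed
qed

text \<open>
  Let \<open>F\<close> be the right-hand side. Multiplying \<open>F'\<close> by \<open>x\<^bsup>2 - p\<^esup>\<close> turns the power \<open>x\<^bsup>p - 2\<^esup>\<close> into a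
  constant, so two further derivatives leave only three powers, with an explicit sign change at \<open>1\<close>. As
  \<open>F\<close> and its first three derivatives vanish at \<open>1\<close>, this sign integrates back up to \<open>F \<ge> 0\<close>.
\<close>

lemma pointwise_power_entropy_inequality:
  fixes p :: real
  assumes p: "1 < p" "p < 2"
  obtains \<kappa> :: real where
    "\<And>x. 0 < x \<Longrightarrow> 0 \<le> x\<^sup>2 - x powr p - 2 * (2 - p) / p * (x powr p * ln x)
        + 2 * (2 - p) / (p - 1) * (x - x powr (p - 1)) + \<kappa> * (x powr p - 1)"
proof -
  define C where "C = 2 * (2 - p) / p"
  define l where "l = 2 * (2 - p) / (p - 1)"
  \<comment> \<open>the value for which \<open>F'\<close> vanishes at \<open>1\<close>\<close>
  define \<kappa> where "\<kappa> = (p + C - 2 - l * (2 - p)) / p"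
  have Cp: "C * p = 2 * (2 - p)" and lp: "l * (p - 1) = 2 * (2 - p)"
    and \<kappa>p: "\<kappa> * p = p + C - 2 - l * (2 - p)"
    using p by (simp_all add: C_def l_def \<kappa>_def)
  define F where "F = (\<lambda>x. x\<^sup>2 - x powr p - C * (x powr p * ln x) + l * (x - x powr (p - 1))
    + \<kappa> * (x powr p - 1))"
  define F1 where "F1 = (\<lambda>x. 2 * x powr (3 - p) - (2 + l * (2 - p)) * x - 2 * (2 - p) * (x * ln x)
    + l * x powr (2 - p) - 2 * (2 - p))"
  define F2 where "F2 = (\<lambda>x. 2 * (3 - p) * x powr (2 - p) - (2 + l * (2 - p)) - 2 * (2 - p) * (ln x + 1)
    + l * (2 - p) * x powr (1 - p))"
  define F3 where "F3 = (\<lambda>x. 2 * (2 - p) * x powr (- p) * ((3 - p) * x - x powr (p - 1) - (2 - p)))"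
  have d: "(F has_real_derivative x powr (p - 2) * F1 x) (at x)" if "0 < x" for x
  proof -
    have "(F has_real_derivative 2 * x - p * x powr (p - 1)
        - C * (p * x powr (p - 1) * ln x + x powr p * (1 / x))
        + l * (1 - (p - 1) * x powr (p - 1 - 1)) + \<kappa> * (p * x powr (p - 1))) (at x)"
      unfolding F_def using that
      by (auto intro!: derivative_eq_intros has_real_derivative_powr)
    also have "2 * x - p * x powr (p - 1)
        - C * (p * x powr (p - 1) * ln x + x powr p * (1 / x))
        + l * (1 - (p - 1) * x powr (p - 1 - 1)) + \<kappa> * (p * x powr (p - 1))
      = 2 * x + (\<kappa> * p - p - C) * x powr (p - 1) - (C * p) * (x powr (p - 1) * ln x)
        + l - (l * (p - 1)) * x powr (p - 2)"
      using that by (simp add: powr_diff) (simp add: field_simps)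
    also have "\<dots> = x powr (p - 2) * F1 x"
    proof -
      have "x powr (p - 2) * x powr (3 - p) = x"
        using that powr_add[of x "p - 2" "3 - p"] by simp
      moreover have "x powr (p - 2) * x = x powr (p - 1)"
        using that powr_add[of x "p - 2" 1] by simp
      moreover have "x powr (p - 2) * x powr (2 - p) = 1"
        using that powr_add[of x "p - 2" "2 - p"] by simp
      moreover have "x powr (p - 2) * F1 x = 2 * (x powr (p - 2) * x powr (3 - p))
          - (2 + l * (2 - p)) * (x powr (p - 2) * x) - 2 * (2 - p) * (x powr (p - 2) * x * ln x)
          + l * (x powr (p - 2) * x powr (2 - p)) - 2 * (2 - p) * x powr (p - 2)"
        by (simp add: F1_def algebra_simps)
      ultimately have "x powr (p - 2) * F1 x = 2 * x - (2 + l * (2 - p)) * x powr (p - 1)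
          - 2 * (2 - p) * (x powr (p - 1) * ln x) + l - 2 * (2 - p) * x powr (p - 2)"
        by (simp only: mult_1_right)
      moreover have "\<kappa> * p - p - C = - (2 + l * (2 - p))"
        unfolding \<kappa>p by simp
      ultimately show ?thesis
        unfolding Cp lp by (simp only: minus_mult_left diff_conv_add_uminus)
    qed
    finally show ?thesis .
  qed
  have d1: "(F1 has_real_derivative F2 x) (at x)" if "0 < x" for x
  proof -
    have "(F1 has_real_derivative 2 * (3 - p) * x powr (3 - p - 1) - (2 + l * (2 - p))
        - 2 * (2 - p) * (ln x + x * (1 / x)) + l * ((2 - p) * x powr (2 - p - 1))) (at x)"
      unfolding F1_def using that
      by (auto intro!: derivative_eq_intros has_real_derivative_powr)
    then show ?thesis
      using that by (simp add: F2_def mult.assoc)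
  qed
  have d2: "(F2 has_real_derivative F3 x) (at x)" if "0 < x" for x
  proof -
    have "(F2 has_real_derivative 2 * (3 - p) * ((2 - p) * x powr (2 - p - 1)) - 2 * (2 - p) * (1 / x)
        + l * (2 - p) * ((1 - p) * x powr (1 - p - 1))) (at x)"
      unfolding F2_def using that
      by (auto intro!: derivative_eq_intros has_real_derivative_powr)
    also have "2 * (3 - p) * ((2 - p) * x powr (2 - p - 1)) - 2 * (2 - p) * (1 / x)
        + l * (2 - p) * ((1 - p) * x powr (1 - p - 1))
      = 2 * (2 - p) * ((3 - p) * x powr (1 - p) - 1 / x) - (l * (p - 1)) * (2 - p) * x powr (- p)"
      by (simp add: algebra_simps)
    also have "\<dots> = F3 x"
    proof -
      have "x powr (- p) * x = x powr (1 - p)"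
        using that powr_add[of x "- p" 1] by simp
      moreover have "x powr (- p) * x powr (p - 1) = 1 / x"
        using that powr_add[of x "- p" "p - 1"] by (simp add: powr_minus_divide)
      moreover have "F3 x = 2 * (2 - p) * ((3 - p) * (x powr (- p) * x) - x powr (- p) * x powr (p - 1)
          - (2 - p) * x powr (- p))"
        by (simp add: F3_def algebra_simps)
      ultimately have "F3 x = 2 * (2 - p) * ((3 - p) * x powr (1 - p) - 1 / x - (2 - p) * x powr (- p))"
        by (simp only:)
      then show ?thesis
        unfolding lp by (simp add: right_diff_distrib)
    qed
    finally show ?thesis .
  qed
  have F3: "x \<le> 1 \<Longrightarrow> F3 x \<le> 0" "1 \<le> x \<Longrightarrow> 0 \<le> F3 x" if "0 < x" for x
    using convex_bracket_sign[OF p that] p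
    by (simp_all add: F3_def mult_nonneg_nonpos)
  have "F2 1 = 0"
    by (simp add: F2_def)
  then have F2: "0 \<le> F2 x" if "0 < x" for x
    using derivative_sign_change_imp_min_at_1[of F2 F3 x] d2 F3 that by simp
  have "F1 1 = l * (p - 1) - 2 * (2 - p)"
    by (simp add: F1_def algebra_simps)
  then have "F1 1 = 0"
    by (simp add: lp)
  have F1: "x \<le> 1 \<Longrightarrow> F1 x \<le> 0" "1 \<le> x \<Longrightarrow> 0 \<le> F1 x" if "0 < x" for x
    using derivative_nonneg_imp_sign_change_at_1[of F1 F2 x] d1 F2 that \<open>F1 1 = 0\<close>
    by simp_all
  have "F 1 \<le> F x" if "0 < x" for x
    using derivative_sign_change_imp_min_at_1[of F "\<lambda>x. x powr (p - 2) * F1 x" x] d F1 that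
    by (simp add: mult_nonneg_nonpos)
  then have nonneg: "0 \<le> F x" if "0 < x" for x
    using that by (simp add: F_def)
  show thesis
    by (rule that) (rule nonneg[unfolded F_def C_def l_def])
qed

section \<open>Following a direction of ascent\<close>

text \<open>
  Among the points of the region where \<open>G\<close> has lost at most \<open>\<epsilon>\<close> per unit of \<open>p\<close>, compactness gives one
  with the largest \<open>p\<close>. If it were short of \<open>b\<close>, a small step in the direction \<open>(1, v)\<close> would stay in the
  region, since \<open>v \<le> R\<close>, and would lose less than allowed, since the derivative there exceeds \<open>-\<epsilon>\<close>.
\<close>

lemma ascending_flow_reaches_end:
  fixes G :: "real \<Rightarrow> real \<Rightarrow> real"
  assumes "a \<le> b" and "0 \<le> R" and "0 < \<epsilon>"
    and cont: "continuous_on ({a..b} \<times> {c..c + R * (b - a)}) (\<lambda>(p, u). G p u)"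
    and ascent: "\<And>p u. a \<le> p \<Longrightarrow> p < b \<Longrightarrow> c \<le> u \<Longrightarrow> u \<le> c + R * (p - a) \<Longrightarrow>
      \<exists>v D. 0 \<le> v \<and> v \<le> R \<and> 0 \<le> D \<and>
        ((\<lambda>h. G (p + h) (u + h * v)) has_real_derivative D) (at 0)"
  shows "\<exists>u\<ge>c. G a c - \<epsilon> * (b - a) \<le> G b u"
proof -
  define K where "K = {a..b} \<times> {c..c + R * (b - a)}"
  define T where "T = {z \<in> K. snd z \<le> c + R * (fst z - a) \<and> G a c - \<epsilon> * (fst z - a) \<le> G (fst z) (snd z)}"
  have "continuous_on K (\<lambda>z. G (fst z) (snd z))"
    using cont by (simp add: K_def case_prod_beta)
  then have "closed {z \<in> K. snd z \<le> c + R * (fst z - a)}"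
    "closed {z \<in> K. G a c - \<epsilon> * (fst z - a) \<le> G (fst z) (snd z)}"
    by (auto intro!: continuous_on_closed_Collect_le continuous_intros closed_Times simp: K_def)
  moreover have "T = K \<inter> ({z \<in> K. snd z \<le> c + R * (fst z - a)}
      \<inter> {z \<in> K. G a c - \<epsilon> * (fst z - a) \<le> G (fst z) (snd z)})"
    by (auto simp: T_def)
  ultimately have "compact T"
    by (auto intro!: compact_Int_closed closed_Int simp: K_def compact_Times)
  moreover have "(a, c) \<in> T"
    using assms by (simp add: T_def K_def)
  moreover have "continuous_on T fst"
    by (intro continuous_intros)
  ultimately obtain s u where su: "(s, u) \<in> T" and max: "\<And>s' u'. (s', u') \<in> T \<Longrightarrow> s' \<le> s"
    using continuous_attains_sup[of T fst] by fastforce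
  have "s = b"
  proof (rule ccontr)
    assume "s \<noteq> b"
    with su have s: "a \<le> s" "s < b" "c \<le> u" "u \<le> c + R * (s - a)"
      "G a c - \<epsilon> * (s - a) \<le> G s u"
      by (auto simp: T_def K_def)
    from ascent[OF s(1-4)] obtain v D where v: "0 \<le> v" "v \<le> R" "0 \<le> D"
      and der: "((\<lambda>h. G (s + h) (u + h * v)) has_real_derivative D) (at 0)"
      by blast
    have "((\<lambda>h. G (s + h) (u + h * v) + \<epsilon> * h) has_real_derivative D + \<epsilon>) (at 0)"
      by (auto intro!: derivative_eq_intros der)
    from DERIV_pos_inc_right[OF this] v \<open>0 < \<epsilon>\<close> obtain d where "d > 0"
      and d: "\<And>h. h > 0 \<Longrightarrow> h < d \<Longrightarrow> G s u < G (s + h) (u + h * v) + \<epsilon> * h"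
      by auto
    define h where "h = min (d / 2) (b - s)"
    have h: "0 < h" "h < d" "s + h \<le> b"
      using \<open>d > 0\<close> s by (auto simp: h_def min_def)
    have hv: "0 \<le> h * v" "h * v \<le> h * R"
      using h v by (simp_all add: mult_left_mono)
    have "R * (s + h - a) \<le> R * (b - a)"
      using h \<open>0 \<le> R\<close> by (intro mult_left_mono) auto
    moreover have "u + h * v \<le> c + R * (s + h - a)"
      using s(4) hv(2) by (simp add: algebra_simps)
    moreover have "G a c - \<epsilon> * (s + h - a) \<le> G (s + h) (u + h * v)"
      using s(5) d[OF h(1,2)] by (simp add: algebra_simps)
    ultimately have "(s + h, u + h * v) \<in> T"
      using s h hv unfolding T_def K_def by simp
    from max[OF this] h show False by simp
  qed
  with su show ?thesis
    by (auto simp: T_def K_def)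
qed

section \<open>Continuity and differentiability in parameters\<close>

text \<open>
  By the mean value theorem the quotient is \<open>D \<xi> u\<close> for some \<open>\<xi>\<close> between \<open>p\<close> and \<open>b\<close>, and \<open>\<xi>\<close> is forced
  to \<open>b\<close> as \<open>p\<close> tends to \<open>b\<close>. This is what makes \<open>\<Psi>\<close> jointly continuous at the endpoint \<open>p = 2\<close>.
\<close>

lemma continuous_on_quotient_extended_by_derivative:
  fixes N D :: "real \<Rightarrow> 'b::metric_space \<Rightarrow> real"
  assumes N: "continuous_on ({a..b} \<times> U) (\<lambda>(p, u). N p u)"
    and D: "continuous_on ({a..b} \<times> U) (\<lambda>(p, u). D p u)"
    and deriv: "\<And>p u. a < p \<Longrightarrow> p < b \<Longrightarrow> u \<in> U \<Longrightarrow> ((\<lambda>p. N p u) has_real_derivative D p u) (at p)"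
  shows "continuous_on ({a..b} \<times> U) (\<lambda>(p, u). if p = b then D b u else (N b u - N p u) / (b - p))"
    (is "continuous_on _ ?G")
proof -
  have "\<exists>\<xi>\<in>{p..b}. ?G (p, u) = D \<xi> u" if "p \<in> {a..b}" "u \<in> U" for p u
  proof (cases "p = b")
    case False
    have "continuous_on {p..b} (\<lambda>p. N p u)"
      using that by (intro continuous_on_compose2[OF N, of _ "\<lambda>p. (p, u)", simplified])
        (auto intro!: continuous_intros)
    moreover have "(\<lambda>p. N p u) differentiable (at z)" if "p < z" "z < b" for z
      using deriv[of z u] that \<open>p \<in> {a..b}\<close> \<open>u \<in> U\<close> by (auto simp: real_differentiable_def)
    moreover have "p < b"
      using that False by auto
    ultimately obtain l z where z: "p < z" "z < b" "((\<lambda>p. N p u) has_real_derivative l) (at z)"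
      "N b u - N p u = (b - p) * l"
      using MVT[of p b "\<lambda>p. N p u"] by blast
    then have "l = D z u"
      using deriv[of z u] that DERIV_unique by auto
    with z show ?thesis
      using False that by (intro bexI[of _ z]) auto
  qed auto
  then have "\<forall>z\<in>{a..b} \<times> U. \<exists>\<xi>. \<xi> \<in> {fst z..b} \<and> ?G z = D \<xi> (snd z)"
    by fastforce
  from bchoice[OF this] obtain \<xi>
    where \<xi>: "\<And>z. z \<in> {a..b} \<times> U \<Longrightarrow> \<xi> z \<in> {fst z..b}"
    and G: "\<And>z. z \<in> {a..b} \<times> U \<Longrightarrow> ?G z = D (\<xi> z) (snd z)"
    by blast
  show ?thesis
  proof (rule continuous_on_sequentiallyI)
    fix w :: "nat \<Rightarrow> real \<times> 'b" and z
    assume w: "\<forall>n. w n \<in> {a..b} \<times> U" and z: "z \<in> {a..b} \<times> U" and lim: "w \<longlonglongrightarrow> z"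
    have lim1: "(\<lambda>n. fst (w n)) \<longlonglongrightarrow> fst z" and lim2: "(\<lambda>n. snd (w n)) \<longlonglongrightarrow> snd z"
      using lim by (auto intro: tendsto_intros)
    show "(\<lambda>n. ?G (w n)) \<longlonglongrightarrow> ?G z"
    proof (cases "fst z = b")
      case True
      let ?\<xi> = "\<lambda>n. \<xi> (w n)"
      have mem: "?\<xi> n \<in> {fst (w n)..b}" for n
        using \<xi> w by blast
      have "?\<xi> \<longlonglongrightarrow> b"
        using mem lim1 True
        by (intro tendsto_sandwich[of "\<lambda>n. fst (w n)" ?\<xi> sequentially "\<lambda>_. b" b]) auto
      then have "(\<lambda>n. (?\<xi> n, snd (w n))) \<longlonglongrightarrow> (b, snd z)"
        using lim2 by (rule tendsto_Pair)
      moreover have "(?\<xi> n, snd (w n)) \<in> {a..b} \<times> U" for n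
        using mem[of n] w[rule_format, of n] by (auto simp: mem_Times_iff)
      ultimately have "(\<lambda>n. D (?\<xi> n) (snd (w n))) \<longlonglongrightarrow> D b (snd z)"
        using D[unfolded continuous_on_sequentially, rule_format,
            of "(b, snd z)" "\<lambda>n. (?\<xi> n, snd (w n))"] z True
        by (auto simp: o_def mem_Times_iff)
      moreover have "?G (w n) = D (?\<xi> n) (snd (w n))" for n
        using G w by blast
      ultimately show ?thesis
        using True by (simp add: case_prod_beta)
    next
      case False
      have "continuous_on ({a..b} \<times> U) (\<lambda>z. N b (snd z))"
        using z by (intro continuous_on_compose2[OF N, of _ "\<lambda>z. (b, snd z)", simplified])
          (auto intro!: continuous_intros)
      then have "(\<lambda>n. N b (snd (w n))) \<longlonglongrightarrow> N b (snd z)"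
        "(\<lambda>n. N (fst (w n)) (snd (w n))) \<longlonglongrightarrow> N (fst z) (snd z)"
        using N w z lim unfolding continuous_on_sequentially
        by (auto simp: o_def case_prod_beta)
      then have "(\<lambda>n. (N b (snd (w n)) - N (fst (w n)) (snd (w n))) / (b - fst (w n)))
          \<longlonglongrightarrow> (N b (snd z) - N (fst z) (snd z)) / (b - fst z)"
        using lim1 False by (intro tendsto_divide tendsto_diff tendsto_const) auto
      moreover have "\<forall>\<^sub>F n in sequentially. fst (w n) \<noteq> b"
        using lim1 False by (simp add: tendsto_imp_eventually_ne)
      ultimately show ?thesis
        using False
        by (simp add: case_prod_beta)
           (erule Lim_transform_eventually, auto elim: eventually_mono)
    qed
  qed
qed

text \<open>
  On the compact set \<open>T \<times> Y\<close> the integrand is bounded, so a constant dominates it.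
\<close>

lemma continuous_on_integral_parameter:
  fixes k :: "'b::metric_space \<Rightarrow> real \<Rightarrow> real"
  assumes M: "finite_measure M" and f: "f \<in> borel_measurable M" "\<And>x. x \<in> space M \<Longrightarrow> f x \<in> Y"
    and "compact T" "compact Y"
    and cont: "continuous_on (T \<times> Y) (\<lambda>(t, y). k t y)"
    and meas: "\<And>t. k t \<in> borel_measurable borel"
  shows "continuous_on T (\<lambda>t. \<integral>x. k t (f x) \<partial>M)"
    and "t \<in> T \<Longrightarrow> integrable M (\<lambda>x. k t (f x))"
proof -
  interpret finite_measure M by fact
  have "compact ((\<lambda>(t, y). k t y) ` (T \<times> Y))"
    using assms by (intro compact_continuous_image compact_Times)
  then obtain K where K: "\<And>t y. t \<in> T \<Longrightarrow> y \<in> Y \<Longrightarrow> \<bar>k t y\<bar> \<le> K"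
    by (fastforce dest!: compact_imp_bounded simp: bounded_iff)
  have [measurable]: "(\<lambda>x. k t (f x)) \<in> borel_measurable M" for t
    using measurable_compose[OF f(1) meas] .
  show "integrable M (\<lambda>x. k t (f x))" if "t \<in> T" for t
    using K f(2) that by (intro integrable_const_bound[of _ K]) auto
  show "continuous_on T (\<lambda>t. \<integral>x. k t (f x) \<partial>M)"
  proof (rule continuous_on_sequentiallyI)
    fix w t assume w: "\<forall>n. w n \<in> T" and t: "t \<in> T" and lim: "w \<longlonglongrightarrow> t"
    show "(\<lambda>n. \<integral>x. k (w n) (f x) \<partial>M) \<longlonglongrightarrow> (\<integral>x. k t (f x) \<partial>M)"
    proof (rule integral_dominated_convergence[where w = "\<lambda>_. K"])
      show "AE x in M. (\<lambda>n. k (w n) (f x)) \<longlonglongrightarrow> k t (f x)"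
      proof (rule AE_I2)
        fix x assume "x \<in> space M"
        then have "(\<lambda>n. (w n, f x)) \<longlonglongrightarrow> (t, f x)" "f x \<in> Y"
          using lim f(2) by (auto intro!: tendsto_intros)
        then show "(\<lambda>n. k (w n) (f x)) \<longlonglongrightarrow> k t (f x)"
          using cont[unfolded continuous_on_sequentially, rule_format, of "(t, f x)" "\<lambda>n. (w n, f x)"]
            w t by (simp add: o_def)
      qed
      show "AE x in M. norm (k (w n) (f x)) \<le> K" for n
        using K w f(2) by (intro AE_I2) auto
    qed auto
  qed
qed

text \<open>
  Differentiation under the integral sign: the mean value theorem bounds all difference quotients by the
  maximum of \<open>k'\<close> on a compact set, and dominated convergence applies.
\<close>

lemma has_real_derivative_integral_parameter:
  fixes k k' :: "real \<Rightarrow> real \<Rightarrow> real"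
  assumes M: "finite_measure M" and f: "f \<in> borel_measurable M" "\<And>x. x \<in> space M \<Longrightarrow> f x \<in> Y"
    and "compact Y" "0 < \<delta>"
    and deriv: "\<And>h y. \<bar>h\<bar> \<le> \<delta> \<Longrightarrow> y \<in> Y \<Longrightarrow> ((\<lambda>h. k h y) has_real_derivative k' h y) (at h)"
    and cont: "continuous_on ({-\<delta>..\<delta>} \<times> Y) (\<lambda>(h, y). k' h y)"
    and int: "\<And>h. \<bar>h\<bar> \<le> \<delta> \<Longrightarrow> integrable M (\<lambda>x. k h (f x))"
    and meas: "k' 0 \<in> borel_measurable borel"
  shows "((\<lambda>h. \<integral>x. k h (f x) \<partial>M) has_real_derivative (\<integral>x. k' 0 (f x) \<partial>M)) (at 0)"
proof -
  interpret finite_measure M by fact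
  have "compact ((\<lambda>(t, y). k' t y) ` ({-\<delta>..\<delta>} \<times> Y))"
    using assms by (intro compact_continuous_image compact_Times) auto
  then obtain K where K: "\<And>h y. \<bar>h\<bar> \<le> \<delta> \<Longrightarrow> y \<in> Y \<Longrightarrow> \<bar>k' h y\<bar> \<le> K"
    by (fastforce dest!: compact_imp_bounded simp: bounded_iff abs_le_iff)
  define q where "q = (\<lambda>h y. (k h y - k 0 y) / h)"
  have qK: "\<bar>q h y\<bar> \<le> K" if "\<bar>h\<bar> \<le> \<delta>" "h \<noteq> 0" "y \<in> Y" for h y
  proof -
    have "norm (k h y - k 0 y) \<le> K * norm (h - 0)"
    proof (rule field_differentiable_bound[of "{-\<delta>..\<delta>}" "\<lambda>h. k h y" "\<lambda>h. k' h y"])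
      show "((\<lambda>h. k h y) has_field_derivative k' z y) (at z within {- \<delta>..\<delta>})"
        if "z \<in> {-\<delta>..\<delta>}" for z
        using deriv[of z y] that \<open>y \<in> Y\<close> by (auto intro: has_field_derivative_at_within)
    qed (use K that in auto)
    then show ?thesis
      using that by (simp add: q_def field_simps abs_divide)
  qed
  have "((\<lambda>h. \<integral>x. q h (f x) \<partial>M) \<longlongrightarrow> (\<integral>x. k' 0 (f x) \<partial>M)) (at 0)"
    unfolding tendsto_at_iff_sequentially
  proof (intro allI impI)
    fix X :: "nat \<Rightarrow> real" assume X: "\<forall>i. X i \<in> UNIV - {0}" "X \<longlonglongrightarrow> 0"
    then obtain n0 where n0: "\<And>n. n \<ge> n0 \<Longrightarrow> \<bar>X n\<bar> \<le> \<delta>"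
      using \<open>0 < \<delta>\<close> unfolding LIMSEQ_iff by (metis diff_zero less_imp_le real_norm_def)
    \<comment> \<open>the bound holds only for small \<open>h\<close>, hence the shift by \<open>n0\<close>\<close>
    have "(\<lambda>n. \<integral>x. q (X (n + n0)) (f x) \<partial>M) \<longlonglongrightarrow> (\<integral>x. k' 0 (f x) \<partial>M)"
    proof (rule integral_dominated_convergence[where w = "\<lambda>_. K"])
      show "AE x in M. (\<lambda>n. q (X (n + n0)) (f x)) \<longlonglongrightarrow> k' 0 (f x)"
      proof (rule AE_I2)
        fix x assume "x \<in> space M"
        then have "((\<lambda>h. q h (f x)) \<longlongrightarrow> k' 0 (f x)) (at 0)"
          using deriv[of 0 "f x"] f(2) \<open>0 < \<delta>\<close> by (simp add: DERIV_def q_def)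
        then have "(\<lambda>n. q (X n) (f x)) \<longlonglongrightarrow> k' 0 (f x)"
          using X unfolding tendsto_at_iff_sequentially by (auto simp: o_def)
        then show "(\<lambda>n. q (X (n + n0)) (f x)) \<longlonglongrightarrow> k' 0 (f x)"
          by (rule LIMSEQ_ignore_initial_segment)
      qed
      show "AE x in M. norm (q (X (n + n0)) (f x)) \<le> K" for n
        using qK n0 X f(2) by (intro AE_I2) auto
      show "(\<lambda>x. q (X (n + n0)) (f x)) \<in> borel_measurable M" for n
        using int[OF n0[of "n + n0"]] int[of 0] \<open>0 < \<delta>\<close>
        by (auto simp: q_def dest!: borel_measurable_integrable)
      show "(\<lambda>x. k' 0 (f x)) \<in> borel_measurable M"
        using measurable_compose[OF f(1) meas] .
    qed auto
    then show "((\<lambda>h. \<integral>x. q h (f x) \<partial>M) \<circ> X) \<longlonglongrightarrow> (\<integral>x. k' 0 (f x) \<partial>M)"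
      by (simp add: o_def LIMSEQ_offset)
  qed
  moreover have "\<forall>\<^sub>F h in at 0. (\<integral>x. q h (f x) \<partial>M)
      = ((\<integral>x. k (0 + h) (f x) \<partial>M) - (\<integral>x. k 0 (f x) \<partial>M)) / h"
    unfolding eventually_at
    using int \<open>0 < \<delta>\<close> by (intro exI[of _ \<delta>]) (auto simp: q_def)
  ultimately show ?thesis
    unfolding DERIV_def by (rule Lim_transform_eventually)
qed


section \<open>Moments of the shifted function\<close>

locale bounded_nonneg_function = prob_space M for M :: "'a measure" +
  fixes f :: "'a \<Rightarrow> real" and B :: real
  assumes f_measurable [measurable]: "f \<in> borel_measurable M"
    and f_bounds: "x \<in> space M \<Longrightarrow> f x \<in> {0..B}"
begin

definition moment :: "real \<Rightarrow> real \<Rightarrow> real" where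
  "moment q c = (\<integral>x. (f x + c) powr q \<partial>M)"

definition log_moment :: "real \<Rightarrow> real \<Rightarrow> real" where
  "log_moment q c = (\<integral>x. (f x + c) powr q * ln (f x + c) \<partial>M)"

lemma B_nonneg: "0 \<le> B"
  using not_empty f_bounds by fastforce

lemma moment_continuous:
  assumes "0 < q\<^sub>0"
  shows "continuous_on ({q\<^sub>0..q\<^sub>1} \<times> {0..c\<^sub>1}) (\<lambda>(q, c). moment q c)"
  unfolding moment_def case_prod_beta
  by (rule continuous_on_integral_parameter(1)[where Y = "{0..B}"])
     (use f_bounds assms in \<open>auto intro!: continuous_intros compact_Times
        continuous_on_powr' finite_measure_axioms simp: case_prod_beta\<close>)

lemma log_moment_continuous:
  assumes "0 < c\<^sub>0"
  shows "continuous_on ({q\<^sub>0..q\<^sub>1} \<times> {c\<^sub>0..c\<^sub>1}) (\<lambda>(q, c). log_moment q c)"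
  unfolding log_moment_def case_prod_beta
  by (rule continuous_on_integral_parameter(1)[where Y = "{0..B}"])
     (use f_bounds assms in \<open>auto intro!: continuous_intros compact_Times
        finite_measure_axioms simp: case_prod_beta\<close>)

lemma integrable_shifted_powr:
  assumes "0 < c"
  shows "integrable M (\<lambda>x. (f x + c) powr q)"
    and "integrable M (\<lambda>x. (f x + c) powr q * ln (f x + c))"
proof -
  show "integrable M (\<lambda>x. (f x + c) powr q)"
    by (rule continuous_on_integral_parameter(2)[where Y = "{0..B}" and T = "{0::real}"
          and k = "\<lambda>_ y. (y + c) powr q"])
       (use f_bounds assms in \<open>auto intro!: continuous_intros finite_measure_axioms
          simp: case_prod_beta\<close>)
  show "integrable M (\<lambda>x. (f x + c) powr q * ln (f x + c))"
    by (rule continuous_on_integral_parameter(2)[where Y = "{0..B}" and T = "{0::real}"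
          and k = "\<lambda>_ y. (y + c) powr q * ln (y + c)"])
       (use f_bounds assms in \<open>auto intro!: continuous_intros finite_measure_axioms
          simp: case_prod_beta\<close>)
qed

lemma moment_bounds:
  assumes "0 < c" "0 < q"
  shows "0 < moment q c" and "moment q c \<le> (B + c) powr q"
proof -
  have "c powr q \<le> moment q c"
    unfolding moment_def using assms f_bounds
    by (intro integral_ge_const integrable_shifted_powr AE_I2 powr_mono2) auto
  then show "0 < moment q c"
    using assms by (smt (verit) powr_gt_zero)
  show "moment q c \<le> (B + c) powr q"
    unfolding moment_def using assms f_bounds
    by (intro integral_le_const integrable_shifted_powr AE_I2 powr_mono2) auto
qed

text \<open>
  The exponent and the shift move along the direction \<open>(w, v)\<close>. Both the derivative of \<open>\<integral> (f + c)\<^sup>2\<close> in \<open>c\<close>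
  alone (\<open>w = 0\<close>) and the derivative of \<open>\<parallel>f + c\<parallel>\<^sub>p\<^sup>2\<close> in a joint direction (\<open>w = 1\<close>) are needed later.
\<close>

lemma moment_has_real_derivative:
  assumes "0 < c"
  shows "((\<lambda>h. moment (q + h * w) (c + h * v)) has_real_derivative
    w * log_moment q c + q * v * moment (q - 1) c) (at 0)"
proof -
  \<comment> \<open>keeps the base \<open>y + c + h v\<close> positive for \<open>\<bar>h\<bar> \<le> \<delta>\<close>\<close>
  define \<delta> where "\<delta> = c / (\<bar>v\<bar> + 1)"
  have "0 < \<delta>"
    using assms by (simp add: \<delta>_def)
  have "\<bar>v\<bar> + 1 \<noteq> 0"
    by linarith
  then have "\<delta> * (\<bar>v\<bar> + 1) = c"
    by (simp add: \<delta>_def)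
  then have "\<delta> * \<bar>v\<bar> < c"
    using \<open>0 < \<delta>\<close> by (simp add: distrib_left)
  have pos: "0 < y + (c + h * v)" if "\<bar>h\<bar> \<le> \<delta>" "y \<in> {0..B}" for h y
  proof -
    have "\<bar>h * v\<bar> \<le> \<delta> * \<bar>v\<bar>"
      using that by (simp add: abs_mult mult_right_mono)
    then show ?thesis
      using \<open>\<delta> * \<bar>v\<bar> < c\<close> that by auto
  qed
  define k where "k = (\<lambda>h y. (y + (c + h * v)) powr (q + h * w))"
  define k' where "k' = (\<lambda>h y. (y + (c + h * v)) powr (q + h * w) *
    (w * ln (y + (c + h * v)) + v * (q + h * w) / (y + (c + h * v))))"
  have "((\<lambda>h. \<integral>x. k h (f x) \<partial>M) has_real_derivative (\<integral>x. k' 0 (f x) \<partial>M)) (at 0)"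
  proof (rule has_real_derivative_integral_parameter[OF finite_measure_axioms f_measurable])
    show "((\<lambda>h. k h y) has_real_derivative k' h y) (at h)" if "\<bar>h\<bar> \<le> \<delta>" "y \<in> {0..B}" for h y
      unfolding k_def k'_def
      by (rule DERIV_powr) (use pos[OF that] in \<open>auto intro!: derivative_eq_intros\<close>)
    have ne: "y + (c + h * v) \<noteq> 0" if "h \<in> {-\<delta>..\<delta>}" "y \<in> {0..B}" for h y
      using pos[of h y] that by (auto simp: abs_le_iff)
    show "continuous_on ({- \<delta>..\<delta>} \<times> {0..B}) (\<lambda>(h, y). k' h y)"
      unfolding k'_def case_prod_beta
      by (intro continuous_intros) (use ne in fastforce)+
    show "integrable M (\<lambda>x. k h (f x))" if "\<bar>h\<bar> \<le> \<delta>" for h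
      unfolding k_def using pos[OF that, of 0] B_nonneg
      by (intro integrable_shifted_powr) simp
    show "k' 0 \<in> borel_measurable borel"
      unfolding k'_def by measurable
  qed (use \<open>0 < \<delta>\<close> f_bounds in auto)
  moreover have "(\<integral>x. k' 0 (f x) \<partial>M) = (\<integral>x. w * ((f x + c) powr q * ln (f x + c))
      + q * v * (f x + c) powr (q - 1) \<partial>M)"
  proof (rule Bochner_Integration.integral_cong[OF refl])
    fix x assume "x \<in> space M"
    then have "0 < f x + c"
      using f_bounds assms by fastforce
    then show "k' 0 (f x) = w * ((f x + c) powr q * ln (f x + c))
        + q * v * (f x + c) powr (q - 1)"
      by (simp add: k'_def powr_diff field_simps)
  qed
  moreover have "\<dots> = w * log_moment q c + q * v * moment (q - 1) c"
    unfolding log_moment_def moment_def using integrable_shifted_powr[OF assms]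
    by simp
  ultimately show ?thesis
    by (simp add: k_def moment_def)
qed

definition norm_sq :: "real \<Rightarrow> real \<Rightarrow> real" where
  "norm_sq p c = moment p c powr (2 / p)"

text \<open>
  The derivative of \<open>norm_sq\<close> in the direction \<open>(1, v)\<close>.
\<close>

definition norm_sq_deriv :: "real \<Rightarrow> real \<Rightarrow> real \<Rightarrow> real" where
  "norm_sq_deriv v p c = norm_sq p c *
    (2 / p * ((log_moment p c + p * v * moment (p - 1) c) / moment p c) - 2 / p\<^sup>2 * ln (moment p c))"

lemma norm_sq_has_real_derivative:
  assumes "0 < c" "0 < p"
  shows "((\<lambda>h. norm_sq (p + h) (c + h * v)) has_real_derivative norm_sq_deriv v p c) (at 0)"
  unfolding norm_sq_def
  by (rule DERIV_cong[OF DERIV_powr[OF moment_has_real_derivative[OF assms(1), of p 1 v, simplified]]])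
     (use assms moment_bounds(1)[OF assms] in \<open>auto intro!: derivative_eq_intros
        simp: norm_sq_deriv_def norm_sq_def power2_eq_square field_simps\<close>)

section \<open>Continuity of the functional in the exponent and the shift\<close>

lemma Psi_shift_eq:
  assumes "0 \<le> c" "1 \<le> p" "p < 2"
  shows "Psi M p (\<lambda>x. f x + c) = (norm_sq 2 c - norm_sq p c) / (2 - p)"
proof -
  have "moment 2 c = (\<integral>x. (f x + c)\<^sup>2 \<partial>M)"
    unfolding moment_def using f_bounds assms
    by (intro Bochner_Integration.integral_cong) fastforce+
  moreover have "0 \<le> moment 2 c"
    unfolding moment_def by simp
  ultimately show ?thesis
    using assms by (simp add: Psi_def norm_sq_def moment_def)
qed

lemma Psi_2_shift_eq:
  assumes "0 < c"
  shows "Psi M 2 (\<lambda>x. f x + c) = norm_sq_deriv 0 2 c"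
proof -
  have m: "moment 2 c = (\<integral>x. (f x + c)\<^sup>2 \<partial>M)"
    unfolding moment_def using f_bounds assms
    by (intro Bochner_Integration.integral_cong) fastforce+
  have "(\<integral>x. (f x + c)\<^sup>2 * ln ((f x + c)\<^sup>2) \<partial>M) = (\<integral>x. 2 * ((f x + c) powr 2 * ln (f x + c)) \<partial>M)"
  proof (intro Bochner_Integration.integral_cong refl)
    fix x assume "x \<in> space M"
    then have "0 < f x + c"
      using f_bounds assms by fastforce
    then show "(f x + c)\<^sup>2 * ln ((f x + c)\<^sup>2) = 2 * ((f x + c) powr 2 * ln (f x + c))"
      by (simp add: ln_realpow)
  qed
  then have "(\<integral>x. (f x + c)\<^sup>2 * ln ((f x + c)\<^sup>2) \<partial>M) = 2 * log_moment 2 c"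
    by (simp add: log_moment_def)
  then have "Psi M 2 (\<lambda>x. f x + c) = log_moment 2 c - moment 2 c * ln (moment 2 c) / 2"
    by (simp add: Psi_def Ent_def m)
  with moment_bounds(1)[of c 2] assms show ?thesis
    by (simp add: norm_sq_deriv_def norm_sq_def right_diff_distrib)
qed

text \<open>
  Shifts are kept away from \<open>0\<close>, so that the logarithm in the derivative at the endpoint \<open>p = 2\<close> stays
  bounded. Away from that endpoint no derivative enters, and the shift \<open>0\<close> can be included, as in
  \<open>continuous_on_Psi_shift_below_2\<close> below.
\<close>

lemma continuous_on_Psi_shift:
  assumes "0 < c\<^sub>0"
  shows "continuous_on ({1..2} \<times> {c\<^sub>0..c\<^sub>1}) (\<lambda>(p, c). Psi M p (\<lambda>x. f x + c))"
proof -
  have pos: "0 < moment p c" if "p \<in> {1..2}" "c \<in> {c\<^sub>0..c\<^sub>1}" for p c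
    using moment_bounds(1)[of c p] that assms by auto
  have sub: "{1..2} \<times> {c\<^sub>0..c\<^sub>1} \<subseteq> {1..2} \<times> {0..c\<^sub>1}"
    using assms by auto
  have m: "continuous_on ({1..2} \<times> {c\<^sub>0..c\<^sub>1}) (\<lambda>z. moment (fst z) (snd z))"
    using continuous_on_subset[OF moment_continuous[of 1 2 c\<^sub>1] sub] by (simp add: case_prod_beta)
  have N: "continuous_on ({1..2} \<times> {c\<^sub>0..c\<^sub>1}) (\<lambda>(p, c). norm_sq p c)"
    unfolding norm_sq_def case_prod_beta
    by (intro continuous_intros m) (use pos in \<open>fastforce\<close>)+
  have L: "continuous_on ({1..2} \<times> {c\<^sub>0..c\<^sub>1}) (\<lambda>z. log_moment (fst z) (snd z))"
    using log_moment_continuous[OF assms, of 1 2 c\<^sub>1] by (simp add: case_prod_beta)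
  have D: "continuous_on ({1..2} \<times> {c\<^sub>0..c\<^sub>1}) (\<lambda>(p, c). norm_sq_deriv 0 p c)"
    unfolding norm_sq_deriv_def case_prod_beta
    by (simp, intro continuous_intros m L N[unfolded case_prod_beta]) (use pos in \<open>fastforce\<close>)+
  have "((\<lambda>p. norm_sq p c) has_real_derivative norm_sq_deriv 0 p c) (at p)"
    if "1 < p" "p < 2" "c \<in> {c\<^sub>0..c\<^sub>1}" for p c
  proof -
    have "((\<lambda>h. norm_sq (h + p) c) has_real_derivative norm_sq_deriv 0 p c) (at 0)"
      using norm_sq_has_real_derivative[of c p 0] that assms by (simp add: add.commute)
    then show ?thesis
      using DERIV_shift[of "\<lambda>p. norm_sq p c" "norm_sq_deriv 0 p c" 0 p] by simp
  qed
  from continuous_on_quotient_extended_by_derivative[OF N D this]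
  show ?thesis
    by (rule continuous_on_eq) (use assms in \<open>auto simp: Psi_shift_eq Psi_2_shift_eq\<close>)
qed

lemma continuous_on_Psi_shift_below_2:
  assumes "b < 2"
  shows "continuous_on ({1..b} \<times> {0..c\<^sub>1}) (\<lambda>(p, c). Psi M p (\<lambda>x. f x + c))"
proof -
  have sub: "{1..b} \<times> {0..c\<^sub>1} \<subseteq> {1..2} \<times> {0..c\<^sub>1}"
    using assms by auto
  have m: "continuous_on ({1..b} \<times> {0..c\<^sub>1}) (\<lambda>z. moment (fst z) (snd z))"
    using continuous_on_subset[OF moment_continuous[of 1 2 c\<^sub>1] sub] by (simp add: case_prod_beta)
  have m2: "continuous_on ({1..b} \<times> {0..c\<^sub>1}) (\<lambda>z. moment 2 (snd z))"
    by (rule continuous_on_compose2[OF moment_continuous[of 1 2 c\<^sub>1], of _ "\<lambda>z. (2, snd z)", simplified])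
       (auto intro!: continuous_intros)
  have nn: "0 \<le> moment q c" for q c
    by (simp add: moment_def)
  have "continuous_on ({1..b} \<times> {0..c\<^sub>1})
      (\<lambda>z. (norm_sq 2 (snd z) - norm_sq (fst z) (snd z)) / (2 - fst z))"
    unfolding norm_sq_def
    by (intro continuous_intros continuous_on_powr' m m2) (use nn assms in auto)
  then show ?thesis
    by (rule continuous_on_eq) (use assms in \<open>auto simp: Psi_shift_eq\<close>)
qed

section \<open>Monotonicity\<close>

text \<open>
  The pointwise inequality is applied to \<open>(f + c) / r\<close>, whose \<open>p\<close>-th moment is \<open>1\<close>, and integrated; the
  multiplier \<open>\<kappa>\<close> then disappears. The factor \<open>r\<^sup>2\<close> undoes the normalisation.
\<close>

lemma integrated_power_entropy_inequality:
  assumes p: "1 < p" "p < 2" and "0 < c"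
  defines "r \<equiv> moment p c powr (1 / p)"
  shows "0 \<le> moment 2 c - r\<^sup>2 - 2 * (2 - p) / p * r\<^sup>2 * (log_moment p c / moment p c - ln r)
    + 2 * (2 - p) / (p - 1) * (r * moment 1 c - r ^ 3 * moment (p - 1) c / moment p c)"
proof -
  from p obtain \<kappa> where \<kappa>: "\<And>x. 0 < x \<Longrightarrow> 0 \<le> x\<^sup>2 - x powr p - 2 * (2 - p) / p * (x powr p * ln x)
        + 2 * (2 - p) / (p - 1) * (x - x powr (p - 1)) + \<kappa> * (x powr p - 1)"
    using pointwise_power_entropy_inequality by blast
  define C where "C = 2 * (2 - p) / p"
  define l where "l = 2 * (2 - p) / (p - 1)"
  define m where "m = moment p c"
  have "0 < m"
    using moment_bounds p \<open>0 < c\<close> by (simp add: m_def)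
  then have "0 < r" and rp: "r powr p = m"
    using p by (simp_all add: r_def m_def powr_powr)
  note int = integrable_shifted_powr[OF \<open>0 < c\<close>]
  define a where "a = - r\<^sup>2 / m + C * r\<^sup>2 * ln r / m + \<kappa> * r\<^sup>2 / m"
  have "0 \<le> (\<integral>x. (f x + c) powr 2 + a * (f x + c) powr p
      - C * r\<^sup>2 / m * ((f x + c) powr p * ln (f x + c)) + l * r * (f x + c) powr 1
      - l * r ^ 3 / m * (f x + c) powr (p - 1) - \<kappa> * r\<^sup>2 \<partial>M)"
  proof (rule integral_nonneg_AE, rule AE_I2)
    fix x assume "x \<in> space M"
    define y where "y = f x + c"
    have "0 < y"
      using f_bounds \<open>x \<in> space M\<close> \<open>0 < c\<close> by (fastforce simp: y_def)
    have "0 \<le> (y / r)\<^sup>2 - (y / r) powr p - C * ((y / r) powr p * ln (y / r))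
        + l * (y / r - (y / r) powr (p - 1)) + \<kappa> * ((y / r) powr p - 1)"
      using \<kappa>[of "y / r"] \<open>0 < y\<close> \<open>0 < r\<close> by (simp add: C_def l_def)
    then have "0 \<le> r\<^sup>2 * \<dots>"
      by simp
    also have "(y / r) powr p = y powr p / m"
      using \<open>0 < y\<close> \<open>0 < r\<close> by (simp add: powr_divide rp)
    also have "(y / r) powr (p - 1) = y powr (p - 1) * r / m"
      using \<open>0 < y\<close> \<open>0 < r\<close> by (simp add: powr_divide powr_diff rp)
    also have "ln (y / r) = ln y - ln r"
      using \<open>0 < y\<close> \<open>0 < r\<close> by (simp add: ln_div)
    also have "r\<^sup>2 * ((y / r)\<^sup>2 - y powr p / m - C * (y powr p / m * (ln y - ln r))
        + l * (y / r - y powr (p - 1) * r / m) + \<kappa> * (y powr p / m - 1))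
      = y powr 2 + a * y powr p - C * r\<^sup>2 / m * (y powr p * ln y) + l * r * y powr 1
      - l * r ^ 3 / m * y powr (p - 1) - \<kappa> * r\<^sup>2"
      using \<open>0 < y\<close> \<open>0 < r\<close> \<open>0 < m\<close>
      by (simp add: a_def power2_eq_square power3_eq_cube field_simps)
    finally show "0 \<le> (f x + c) powr 2 + a * (f x + c) powr p
      - C * r\<^sup>2 / m * ((f x + c) powr p * ln (f x + c)) + l * r * (f x + c) powr 1
      - l * r ^ 3 / m * (f x + c) powr (p - 1) - \<kappa> * r\<^sup>2"
      unfolding y_def .
  qed
  also have "\<dots> = moment 2 c + a * m - C * r\<^sup>2 / m * log_moment p c + l * r * moment 1 c
      - l * r ^ 3 / m * moment (p - 1) c - \<kappa> * r\<^sup>2"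
    unfolding moment_def log_moment_def m_def using int by (simp add: prob_space del: powr_one')
  also have "\<dots> = moment 2 c - r\<^sup>2 - C * r\<^sup>2 * (log_moment p c / m - ln r)
      + l * (r * moment 1 c - r ^ 3 * moment (p - 1) c / m)"
    using \<open>0 < m\<close> by (simp add: a_def field_simps)
  finally show ?thesis
    unfolding C_def l_def m_def .
qed

text \<open>
  The shift derivative of \<open>(2 - p) \<Psi>\<^sub>p(f + c)\<close> is \<open>2 (\<integral> g - r\<^bsup>2 - p\<^esup> \<integral> g\<^bsup>p - 1\<^esup>)\<close> for
  \<open>g = f + c\<close> and \<open>r = \<parallel>g\<parallel>\<^sub>p\<close>. The speed \<open>r / (p - 1)\<close> gives it exactly the weight that it carries in the
  integrated inequality.
\<close>

lemma Psi_ascent_direction: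
  assumes p: "1 < p" "p < 2" and "0 < c"
  defines "v \<equiv> moment p c powr (1 / p) / (p - 1)"
  shows "\<exists>D\<ge>0. ((\<lambda>h. Psi M (p + h) (\<lambda>x. f x + (c + h * v))) has_real_derivative D) (at 0)"
proof -
  define r where "r = moment p c powr (1 / p)"
  have m: "0 < moment p c"
    using moment_bounds p \<open>0 < c\<close> by simp
  then have "0 < r" and ln_m: "ln (moment p c) = p * ln r" and N: "norm_sq p c = r\<^sup>2"
    using p by (simp_all add: r_def norm_sq_def ln_powr powr_powr flip: powr_numeral)
  have nn: "0 \<le> moment 2 u" for u
    by (simp add: moment_def)
  define E' where "E' = 2 * v * moment 1 c - norm_sq_deriv v p c"
  define G where "G = (\<lambda>h. (moment 2 (c + h * v) - norm_sq (p + h) (c + h * v)) / (2 - (p + h)))"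
  have "(G has_real_derivative (E' * (2 - p) + (moment 2 c - r\<^sup>2)) / (2 - p)\<^sup>2) (at 0)"
  proof -
    have d: "((\<lambda>h. 2 - (p + h)) has_real_derivative - 1) (at 0)"
      by (auto intro!: derivative_eq_intros)
    have "((\<lambda>h. moment 2 (c + h * v)) has_real_derivative 2 * v * moment 1 c) (at 0)"
      using moment_has_real_derivative[OF \<open>0 < c\<close>, of 2 0 v] by simp
    moreover have "((\<lambda>h. norm_sq (p + h) (c + h * v)) has_real_derivative norm_sq_deriv v p c) (at 0)"
      using norm_sq_has_real_derivative[OF \<open>0 < c\<close>, of p v] p by simp
    ultimately have "((\<lambda>h. moment 2 (c + h * v) - norm_sq (p + h) (c + h * v))
        has_real_derivative E') (at 0)"
      unfolding E'_def by (rule DERIV_diff)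
    from DERIV_divide[OF this d] show ?thesis
      unfolding G_def using p by (simp add: N power2_eq_square diff_diff_eq2 add_diff_eq)
  qed
  moreover have "0 \<le> E' * (2 - p) + (moment 2 c - r\<^sup>2)"
  proof -
    have "E' * (2 - p) + (moment 2 c - r\<^sup>2)
      = moment 2 c - r\<^sup>2 - 2 * (2 - p) / p * r\<^sup>2 * (log_moment p c / moment p c - ln r)
    + 2 * (2 - p) / (p - 1) * (r * moment 1 c - r ^ 3 * moment (p - 1) c / moment p c)"
      unfolding E'_def norm_sq_deriv_def N ln_m v_def r_def[symmetric]
      using p m by (simp add: divide_simps) (simp add: algebra_simps power2_eq_square power3_eq_cube)
    then show ?thesis
      using integrated_power_entropy_inequality[OF p \<open>0 < c\<close>] by (simp add: r_def)
  qed
  moreover have "((\<lambda>h. Psi M (p + h) (\<lambda>x. f x + (c + h * v))) has_real_derivative D) (at 0)"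
    if "(G has_real_derivative D) (at 0)" for D
  proof (rule has_field_derivative_transform_within_open[OF that,
        of "{1 - p<..<2 - p} \<inter> {h. 0 < c + h * v}"])
    show "open ({1 - p<..<2 - p} \<inter> {h. 0 < c + h * v})"
      by (intro open_Int open_Collect_less continuous_intros)
    show "G h = Psi M (p + h) (\<lambda>x. f x + (c + h * v))"
      if "h \<in> {1 - p<..<2 - p} \<inter> {h. 0 < c + h * v}" for h
      using that nn by (simp add: Psi_shift_eq G_def norm_sq_def)
  qed (use p \<open>0 < c\<close> in auto)
  ultimately show ?thesis
    by (meson divide_nonneg_nonneg zero_le_power2)
qed

lemma Psi_le_M_sup:
  "0 \<le> c \<Longrightarrow> ereal (Psi M p (\<lambda>x. f x + c)) \<le> M_sup M p f"
  unfolding M_sup_def by (rule SUP_upper) simp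

text \<open>
  The constant \<open>R\<close> bounds the speed on the whole region: there
  \<open>\<parallel>f + u\<parallel>\<^sub>p \<le> B + u \<le> R (a - 1) + R (p - a) = R (p - 1)\<close>.
\<close>

lemma Psi_le_later_M_sup:
  assumes "1 < a" "a < b" "b \<le> 2" "0 < c"
  shows "ereal (Psi M a (\<lambda>x. f x + c)) \<le> M_sup M b f"
proof -
  define R where "R = (B + c) / (a - 1)"
  have R: "R * (a - 1) = B + c" and "0 \<le> R"
    using assms B_nonneg by (simp_all add: R_def)
  have ascent: "\<exists>v D. 0 \<le> v \<and> v \<le> R \<and> 0 \<le> D \<and>
      ((\<lambda>h. Psi M (p + h) (\<lambda>x. f x + (u + h * v))) has_real_derivative D) (at 0)"
    if "a \<le> p" "p < b" "c \<le> u" "u \<le> c + R * (p - a)" for p u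
  proof -
    define v where "v = moment p u powr (1 / p) / (p - 1)"
    have pu: "1 < p" "p < 2" "0 < u"
      using that assms by auto
    have "moment p u powr (1 / p) \<le> ((B + u) powr p) powr (1 / p)"
      using moment_bounds[of u p] pu by (intro powr_mono2) auto
    also have "\<dots> = B + u"
      using pu B_nonneg by (simp add: powr_powr)
    also have "\<dots> \<le> R * (a - 1) + R * (p - a)"
      using that R by simp
    also have "\<dots> = R * (p - 1)"
      by (simp add: algebra_simps)
    finally have "v \<le> R"
      using pu by (simp add: v_def pos_divide_le_eq)
    moreover have "0 \<le> v"
      using pu by (simp add: v_def)
    ultimately show ?thesis
      using Psi_ascent_direction[OF pu] unfolding v_def by blast
  qed
  have cont: "continuous_on ({a..b} \<times> {c..c + R * (b - a)}) (\<lambda>(p, u). Psi M p (\<lambda>x. f x + u))"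
    by (rule continuous_on_subset[OF continuous_on_Psi_shift[OF \<open>0 < c\<close>]]) (use assms in auto)
  show ?thesis
  proof (rule ereal_le_epsilon2)
    fix e :: real assume "0 < e"
    then have "0 < e / (b - a)"
      using assms by simp
    from ascending_flow_reaches_end[OF less_imp_le[OF \<open>a < b\<close>] \<open>0 \<le> R\<close> this cont ascent]
    obtain u where u: "c \<le> u" "Psi M a (\<lambda>x. f x + c) - e \<le> Psi M b (\<lambda>x. f x + u)"
      using assms by auto
    have "ereal (Psi M a (\<lambda>x. f x + c)) \<le> ereal (Psi M b (\<lambda>x. f x + u)) + ereal e"
      using u by simp
    also have "\<dots> \<le> M_sup M b f + ereal e"
      using u assms by (intro add_right_mono Psi_le_M_sup) auto
    finally show "ereal (Psi M a (\<lambda>x. f x + c)) \<le> M_sup M b f + ereal e" .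
  qed
qed

text \<open>
  Approaching \<open>(p, c)\<close> along \<open>(p + t, c + t)\<close> with \<open>t > 0\<close> reduces the cases \<open>p = 1\<close> and \<open>c = 0\<close> to the
  interior ones.
\<close>

lemma M_sup_mono:
  assumes "1 \<le> p" "p < q" "q \<le> 2"
  shows "M_sup M p f \<le> M_sup M q f"
proof -
  have "ereal (Psi M p (\<lambda>x. f x + c)) \<le> M_sup M q f" if "0 \<le> c" for c
  proof (rule tendsto_upperbound)
    let ?S = "{1..(p + q) / 2} \<times> {0..c + 1}"
    have small: "\<forall>\<^sub>F t in at_right 0. t \<in> {0<..<min 1 ((q - p) / 2)}"
      using assms by (intro eventually_at_right_real) auto
    have "((\<lambda>t. case (p + t, c + t) of (p, c) \<Rightarrow> Psi M p (\<lambda>x. f x + c)) \<longlongrightarrow>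
        (case (p, c) of (p, c) \<Rightarrow> Psi M p (\<lambda>x. f x + c))) (at_right 0)"
    proof (rule continuous_on_tendsto_compose[OF continuous_on_Psi_shift_below_2])
      show "(p + q) / 2 < 2"
        using assms by simp
      show "((\<lambda>t. (p + t, c + t)) \<longlongrightarrow> (p, c)) (at_right 0)"
        by (auto intro!: tendsto_eq_intros)
      show "(p, c) \<in> ?S"
        using assms that by simp
      show "\<forall>\<^sub>F t in at_right 0. (p + t, c + t) \<in> ?S"
        using small by eventually_elim (use assms that in \<open>auto simp: field_simps\<close>)
    qed
    then show "((\<lambda>t. ereal (Psi M (p + t) (\<lambda>x. f x + (c + t)))) \<longlongrightarrow>
        ereal (Psi M p (\<lambda>x. f x + c))) (at_right 0)"
      by simp
    show "\<forall>\<^sub>F t in at_right 0. ereal (Psi M (p + t) (\<lambda>x. f x + (c + t))) \<le> M_sup M q f"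
      using small
      by eventually_elim (use assms that in \<open>auto intro!: Psi_le_later_M_sup\<close>)
  qed auto
  then show ?thesis
    unfolding M_sup_def[of M p] by (intro SUP_least) simp
qed

end

theorem proposition1p1:
  fixes \<mu> :: "'a measure" and f :: "'a \<Rightarrow> real"
  assumes "prob_space \<mu>"
    and "f \<in> borel_measurable \<mu>"
    and "\<And>x. x \<in> space \<mu> \<Longrightarrow> 0 \<le> f x"
    and "bounded (f ` space \<mu>)"
  shows "mono_on {1..2} (\<lambda>p. M_sup \<mu> p f)"
proof (rule mono_onI)
  fix p q :: real
  assume pq: "p \<in> {1..2}" "q \<in> {1..2}" "p \<le> q"
  obtain B where B: "\<And>x. x \<in> space \<mu> \<Longrightarrow> \<bar>f x\<bar> \<le> B"
    using assms(4) by (auto simp: bounded_iff)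
  interpret bounded_nonneg_function \<mu> f B
    using assms B
    by (intro bounded_nonneg_function.intro bounded_nonneg_function_axioms.intro) fastforce+
  show "M_sup \<mu> p f \<le> M_sup \<mu> q f"
    using M_sup_mono[of p q] pq by (cases "p = q") auto
qed

end
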